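(* Let $A$ be a free abelian group of rank $2k$ ($k\ge1$), let $\langle\cdot,\cdot\rangle$ be an integral symplectic form on $A$, and let $\Gamma$ be the associated Heisenberg group, that is, the set $A\times\mathbb Z$ with group law $$(a,z)(a',z')=(a+a',\,z+z'+\langle a,a'\rangle).$$ Let $\mathfrak K$ be the conjugacy class of a noncentral element of $\Gamma$. Then $$N_{\mathfrak K}(n)\asymp n^2 .$$
   Context: The group $\Gamma$ is finitely generated; fix a finite generating set $S$, let $d_S$ be the associated left-invariant word metric, and let $N_{\mathfrak K}(n)=\operatorname{Card}(\mathfrak K\cap B_{d_S}(e,n))$ be the number of elements of $\mathfrak K$ in the ball of radius $n$ centred at the identity $e$. For two maps $f,g:\mathbb N\to[0,+\infty)$, $f\asymp g$ means that there exists an integer $c\ge1$ such that $g(n)\le f(cn)$ and $f(n)\le g(cn)$ for every $n\in\mathbb N$. Up to $\asymp$, the function $N_{\mathfrak K}$ does not depend on $S$. A symplectic form is a nondegenerate alternating bilinear form, here with values in $\mathbb Z$. *)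

theory Defs
  imports "HOL-Algebra.Algebra"
begin

definition free_abelian_of_rank :: "'a monoid \<Rightarrow> nat \<Rightarrow> bool" where
  "free_abelian_of_rank A n \<longleftrightarrow> comm_group A \<and> A \<cong> free_Abelian_group {..<n}"

text \<open>Nondegeneracy means that the radical is trivial (unimodularity is not required).  Since the
  form is alternating, hence antisymmetric, its left and right radicals coincide.\<close>

definition symplectic_form :: "'a monoid \<Rightarrow> ('a \<Rightarrow> 'a \<Rightarrow> int) \<Rightarrow> bool" where
  "symplectic_form A \<omega> \<longleftrightarrow>
     (\<forall>a\<in>carrier A. \<forall>b\<in>carrier A. \<forall>c\<in>carrier A. \<omega> (a \<otimes>\<^bsub>A\<^esub> b) c = \<omega> a c + \<omega> b c) \<and>
     (\<forall>a\<in>carrier A. \<forall>b\<in>carrier A. \<forall>c\<in>carrier A. \<omega> a (b \<otimes>\<^bsub>A\<^esub> c) = \<omega> a b + \<omega> a c) \<and>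
     (\<forall>a\<in>carrier A. \<omega> a a = 0) \<and>
     (\<forall>a\<in>carrier A. (\<forall>b\<in>carrier A. \<omega> a b = 0) \<longrightarrow> a = \<one>\<^bsub>A\<^esub>)"

definition heisenberg_group :: "'a monoid \<Rightarrow> ('a \<Rightarrow> 'a \<Rightarrow> int) \<Rightarrow> ('a \<times> int) monoid" where
  "heisenberg_group A \<omega> =
     \<lparr>carrier = carrier A \<times> UNIV,
      monoid.mult = (\<lambda>(a, z) (a', z'). (a \<otimes>\<^bsub>A\<^esub> a', z + z' + \<omega> a a')),
      one = (\<one>\<^bsub>A\<^esub>, 0)\<rparr>"

lemma group_heisenberg_group:
  assumes "comm_group A" and sf: "symplectic_form A \<omega>"
  shows "group (heisenberg_group A \<omega>)"
proof -
  interpret A: comm_group A by fact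
  have add_l: "\<omega> (a \<otimes>\<^bsub>A\<^esub> b) c = \<omega> a c + \<omega> b c"
    and add_r: "\<omega> c (a \<otimes>\<^bsub>A\<^esub> b) = \<omega> c a + \<omega> c b"
    if "a \<in> carrier A" "b \<in> carrier A" "c \<in> carrier A" for a b c
    using sf that by (auto simp: symplectic_form_def)
  have one_l: "\<omega> \<one>\<^bsub>A\<^esub> c = 0" if "c \<in> carrier A" for c
    using add_l[of "\<one>\<^bsub>A\<^esub>" "\<one>\<^bsub>A\<^esub>" c] that by simp
  show ?thesis
  proof (rule groupI)
    fix x assume "x \<in> carrier (heisenberg_group A \<omega>)"
    then obtain a z where x: "x = (a, z)" "a \<in> carrier A"
      by (auto simp: heisenberg_group_def)
    have "(inv\<^bsub>A\<^esub> a, - z - \<omega> (inv\<^bsub>A\<^esub> a) a) \<otimes>\<^bsub>heisenberg_group A \<omega>\<^esub> x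
        = \<one>\<^bsub>heisenberg_group A \<omega>\<^esub>"
      using x by (simp add: heisenberg_group_def)
    moreover have "(inv\<^bsub>A\<^esub> a, - z - \<omega> (inv\<^bsub>A\<^esub> a) a) \<in> carrier (heisenberg_group A \<omega>)"
      using x by (simp add: heisenberg_group_def)
    ultimately show "\<exists>y\<in>carrier (heisenberg_group A \<omega>).
        y \<otimes>\<^bsub>heisenberg_group A \<omega>\<^esub> x = \<one>\<^bsub>heisenberg_group A \<omega>\<^esub>"
      by blast
  qed (auto simp: heisenberg_group_def add_l add_r one_l A.m_assoc)
qed

definition group_center :: "('a, 'b) monoid_scheme \<Rightarrow> 'a set" where
  "group_center G = {x \<in> carrier G. \<forall>g\<in>carrier G. g \<otimes>\<^bsub>G\<^esub> x = x \<otimes>\<^bsub>G\<^esub> g}"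

definition conjugacy_class :: "('a, 'b) monoid_scheme \<Rightarrow> 'a \<Rightarrow> 'a set" where
  "conjugacy_class G x = {g \<otimes>\<^bsub>G\<^esub> x \<otimes>\<^bsub>G\<^esub> inv\<^bsub>G\<^esub> g | g. g \<in> carrier G}"

definition finite_generating_set :: "('a, 'b) monoid_scheme \<Rightarrow> 'a set \<Rightarrow> bool" where
  "finite_generating_set G S \<longleftrightarrow> finite S \<and> S \<subseteq> carrier G \<and> generate G S = carrier G"

definition group_words :: "('a, 'b) monoid_scheme \<Rightarrow> 'a set \<Rightarrow> 'a list set" where
  "group_words G S = lists (S \<union> m_inv G ` S)"

definition word_length :: "('a, 'b) monoid_scheme \<Rightarrow> 'a set \<Rightarrow> 'a \<Rightarrow> nat" where
  "word_length G S g =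
     (LEAST n. \<exists>w\<in>group_words G S. length w = n \<and> foldr (\<otimes>\<^bsub>G\<^esub>) w \<one>\<^bsub>G\<^esub> = g)"

definition word_dist :: "('a, 'b) monoid_scheme \<Rightarrow> 'a set \<Rightarrow> 'a \<Rightarrow> 'a \<Rightarrow> nat" where
  "word_dist G S g h = word_length G S (inv\<^bsub>G\<^esub> g \<otimes>\<^bsub>G\<^esub> h)"

definition word_ball :: "('a, 'b) monoid_scheme \<Rightarrow> 'a set \<Rightarrow> 'a \<Rightarrow> nat \<Rightarrow> 'a set" where
  "word_ball G S g n = {h \<in> carrier G. word_dist G S g h \<le> n}"

definition ball_count :: "('a, 'b) monoid_scheme \<Rightarrow> 'a set \<Rightarrow> 'a set \<Rightarrow> nat \<Rightarrow> nat" where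
  "ball_count G S K n = card (K \<inter> word_ball G S \<one>\<^bsub>G\<^esub> n)"

text \<open>Two facts showing that \<open>word_length\<close> and \<open>ball_count\<close> never take a default value: every
  element is represented by a word, and balls are finite.\<close>

lemma word_exists:
  assumes "group G" "finite_generating_set G S" "g \<in> carrier G"
  shows "\<exists>w\<in>group_words G S. length w = word_length G S g \<and> foldr (\<otimes>\<^bsub>G\<^esub>) w \<one>\<^bsub>G\<^esub> = g"
proof -
  interpret group G by fact
  have S: "S \<subseteq> carrier G" "generate G S = carrier G"
    using assms(2) by (auto simp: finite_generating_set_def)
  have closed: "foldr (\<otimes>\<^bsub>G\<^esub>) w \<one>\<^bsub>G\<^esub> \<in> carrier G" if "w \<in> group_words G S" for w
    using that S by (induction w) (auto simp: group_words_def)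
  have app: "foldr (\<otimes>\<^bsub>G\<^esub>) (v @ w) \<one>\<^bsub>G\<^esub> = foldr (\<otimes>\<^bsub>G\<^esub>) v \<one>\<^bsub>G\<^esub> \<otimes>\<^bsub>G\<^esub> foldr (\<otimes>\<^bsub>G\<^esub>) w \<one>\<^bsub>G\<^esub>"
    if "v \<in> group_words G S" "w \<in> group_words G S" for v w
    using that(1)
  proof (induction v)
    case Nil
    then show ?case using closed[OF that(2)] by simp
  next
    case (Cons x v)
    have x: "x \<in> carrier G" and v: "v \<in> group_words G S"
      using Cons.prems S by (auto simp: group_words_def)
    then show ?case
      using Cons.IH[OF v] closed[OF v] closed[OF that(2)] by (simp add: m_assoc)
  qed
  have "g \<in> generate G S"
    using assms(3) S by simp
  then have "\<exists>w\<in>group_words G S. foldr (\<otimes>\<^bsub>G\<^esub>) w \<one>\<^bsub>G\<^esub> = g"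
  proof (induction rule: generate.induct)
    case one
    show ?case by (rule bexI[of _ "[]"]) (auto simp: group_words_def)
  next
    case (incl h)
    then show ?case using S by (intro bexI[of _ "[h]"]) (auto simp: group_words_def)
  next
    case (inv h)
    then have "h \<in> carrier G" using S by auto
    then show ?case using inv by (intro bexI[of _ "[inv\<^bsub>G\<^esub> h]"]) (auto simp: group_words_def)
  next
    case (eng h1 h2)
    then obtain v w where vw: "v \<in> group_words G S" "w \<in> group_words G S"
      "foldr (\<otimes>\<^bsub>G\<^esub>) v \<one>\<^bsub>G\<^esub> = h1" "foldr (\<otimes>\<^bsub>G\<^esub>) w \<one>\<^bsub>G\<^esub> = h2"
      by blast
    have "v @ w \<in> group_words G S"
      using vw by (auto simp: group_words_def)
    then show ?case using app[OF vw(1,2)] vw(3,4) by blast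
  qed
  then have "\<exists>n. \<exists>w\<in>group_words G S. length w = n \<and> foldr (\<otimes>\<^bsub>G\<^esub>) w \<one>\<^bsub>G\<^esub> = g"
    by blast
  then show ?thesis
    unfolding word_length_def by (rule LeastI_ex)
qed

lemma finite_word_ball:
  assumes "group G" "finite_generating_set G S"
  shows "finite (word_ball G S \<one>\<^bsub>G\<^esub> n)"
proof -
  interpret group G by fact
  let ?T = "S \<union> m_inv G ` S"
  have "word_ball G S \<one>\<^bsub>G\<^esub> n
      \<subseteq> (\<lambda>w. foldr (\<otimes>\<^bsub>G\<^esub>) w \<one>\<^bsub>G\<^esub>) ` {w. set w \<subseteq> ?T \<and> length w \<le> n}"
  proof
    fix h assume h: "h \<in> word_ball G S \<one>\<^bsub>G\<^esub> n"
    then have hG: "h \<in> carrier G" and len: "word_length G S h \<le> n"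
      by (auto simp: word_ball_def word_dist_def)
    obtain w where "w \<in> group_words G S" "length w = word_length G S h"
      "foldr (\<otimes>\<^bsub>G\<^esub>) w \<one>\<^bsub>G\<^esub> = h"
      using word_exists[OF assms hG] by blast
    then show "h \<in> (\<lambda>w. foldr (\<otimes>\<^bsub>G\<^esub>) w \<one>\<^bsub>G\<^esub>) ` {w. set w \<subseteq> ?T \<and> length w \<le> n}"
      using len by (intro image_eqI[of _ _ w]) (auto simp: group_words_def)
  qed
  moreover have "finite {w. set w \<subseteq> ?T \<and> length w \<le> n}"
    using assms(2) by (intro finite_lists_length_le) (auto simp: finite_generating_set_def)
  ultimately show ?thesis
    by (meson finite_imageI finite_subset)
qed

text \<open>Only used for functions with nonnegative values.\<close>

definition growth_equiv :: "(nat \<Rightarrow> real) \<Rightarrow> (nat \<Rightarrow> real) \<Rightarrow> bool" (infix \<open>\<asymp>\<close> 50) where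
  "f \<asymp> g \<longleftrightarrow> (\<exists>c::nat. c \<ge> 1 \<and> (\<forall>n. g n \<le> f (c * n) \<and> f n \<le> g (c * n)))"

end

theory Submission
  imports Defs
begin

text \<open>
  Write \<open>\<gamma> = (a, z)\<close>.  Conjugation by \<open>(b, y)\<close> fixes the horizontal coordinate \<open>a\<close> and
  adds \<open>2 * \<omega> b a\<close> to the vertical one, so the class of \<open>\<gamma>\<close> lies on a single vertical line, and
  since \<open>\<gamma>\<close> is not central some \<open>b\<close> has \<open>e = \<omega> b a \<noteq> 0\<close>.  The growth is quadratic because
  the centre of a Heisenberg group is quadratically distorted, which is used in both directions.

  For the upper bound, the vertical coordinate of a product of \<open>n\<close> letters is the sum of \<open>n\<close>
  vertical coordinates and of at most \<open>n^2\<close> values of \<open>\<omega>\<close> on pairs of letters, hence it is at most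
  \<open>M * n^2\<close> in absolute value (\<open>vertical_coordinate_le\<close>).  A vertical line therefore meets the ball
  of radius \<open>n\<close> in at most \<open>2 * M * n^2 + 1\<close> points.

  For the lower bound, let \<open>x = (b, 0)\<close>.  The commutator of \<open>x^p\<close> and \<open>\<gamma>^n\<close> is the central
  element \<open>(1, 2 * p * n * e)\<close>, and the conjugate of \<open>\<gamma>\<close> by \<open>x^q\<close> is \<open>(a, z + 2 * q * e)\<close>.  Their
  product is the conjugate of \<open>\<gamma>\<close> by \<open>x^m\<close> with \<open>m = p * n + q\<close>.  Letting \<open>p\<close> and \<open>q\<close> run through
  the digits below \<open>n\<close> yields \<open>n^2\<close> distinct conjugates, all of length at most a constant times \<open>n\<close>
  although \<open>m\<close> itself runs up to \<open>n^2\<close> (\<open>word_length_conj_pow_le\<close>).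
\<close>

section \<open>Word length\<close>

locale finitely_generated_group = group G for G (structure) +
  fixes S
  assumes fin_gen: "finite_generating_set G S"
begin

lemma letters_carrier: "S \<union> m_inv G ` S \<subseteq> carrier G"
  using fin_gen by (auto simp: finite_generating_set_def)

lemma finite_letters: "finite (S \<union> m_inv G ` S)"
  using fin_gen by (auto simp: finite_generating_set_def)

lemma word_prod_closed:
  "w \<in> group_words G S \<Longrightarrow> foldr (\<otimes>) w \<one> \<in> carrier G"
  using letters_carrier by (induction w) (auto simp: group_words_def)

lemma word_prod_append:
  assumes "v \<in> group_words G S" "w \<in> group_words G S"
  shows "foldr (\<otimes>) (v @ w) \<one> = foldr (\<otimes>) v \<one> \<otimes> foldr (\<otimes>) w \<one>"
  using assms(1)
proof (induction v)
  case Nil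
  then show ?case using word_prod_closed[OF assms(2)] by simp
next
  case (Cons x v)
  then have "x \<in> carrier G" "v \<in> group_words G S"
    using letters_carrier by (auto simp: group_words_def)
  then show ?case
    using Cons.IH word_prod_closed assms(2) by (simp add: m_assoc)
qed

lemma word_length_le:
  "w \<in> group_words G S \<Longrightarrow> word_length G S (foldr (\<otimes>) w \<one>) \<le> length w"
  unfolding word_length_def by (rule Least_le) blast

lemma word_of_length:
  assumes "g \<in> carrier G"
  obtains w where "w \<in> group_words G S" "length w = word_length G S g" "foldr (\<otimes>) w \<one> = g"
  using word_exists[OF is_group fin_gen assms] by blast

lemma word_length_one: "word_length G S \<one> = 0"
  using word_length_le[of "[]"] by (simp add: group_words_def)

lemma word_length_mult_le:
  assumes "g \<in> carrier G" "h \<in> carrier G"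
  shows "word_length G S (g \<otimes> h) \<le> word_length G S g + word_length G S h"
proof -
  obtain v w where "v \<in> group_words G S" "length v = word_length G S g" "foldr (\<otimes>) v \<one> = g"
    and "w \<in> group_words G S" "length w = word_length G S h" "foldr (\<otimes>) w \<one> = h"
    using word_of_length assms by metis
  then show ?thesis
    using word_length_le[of "v @ w"] word_prod_append[of v w] by (auto simp: group_words_def)
qed

lemma word_length_pow_le:
  assumes "g \<in> carrier G"
  shows "word_length G S (g [^] (n::nat)) \<le> n * word_length G S g"
proof (induction n)
  case 0
  then show ?case by (simp add: word_length_one)
next
  case (Suc n)
  then show ?case using word_length_mult_le[of "g [^] n" g] assms by simp
qed

lemma mem_word_ball_one_iff:
  "g \<in> word_ball G S \<one> n \<longleftrightarrow> g \<in> carrier G \<and> word_length G S g \<le> n"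
  by (auto simp: word_ball_def word_dist_def)

lemma word_ball_zero: "word_ball G S \<one> 0 = {\<one>}"
proof -
  have "g = \<one>" if "g \<in> carrier G" "word_length G S g = 0" for g
    using word_of_length[OF that(1)] that(2) by auto
  then show ?thesis
    by (auto simp: mem_word_ball_one_iff word_length_one)
qed

text \<open>The commutator of \<open>x^p\<close> and \<open>g^n\<close> times the conjugate of \<open>g\<close> by \<open>x^q\<close> is a word in
  which \<open>x\<close>, \<open>g\<close> and their inverses occur linearly often.  When commutators are central this element
  is the conjugate of \<open>g\<close> by \<open>x^(p * n + q)\<close>, for which it is a drastic shortcut.\<close>

lemma word_length_commutator_conj_le:
  assumes x: "x \<in> carrier G" and g: "g \<in> carrier G" and "p < n" "q < n"
  shows "word_length G S
           ((x [^] p \<otimes> g [^] n \<otimes> inv (x [^] p) \<otimes> inv (g [^] n)) \<otimes> (x [^] q \<otimes> g \<otimes> inv (x [^] q)))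
         \<le> 2 * (word_length G S x + word_length G S (inv x)
               + word_length G S g + word_length G S (inv g)) * n"
    (is "word_length G S ?h \<le> 2 * ?L * n")
proof -
  let ?l = "word_length G S"
  have pow: "?l (y [^] i) \<le> n * ?l y" if "y \<in> carrier G" "i \<le> n" for y i
    by (rule order_trans[OF word_length_pow_le[OF that(1)] mult_le_mono1[OF that(2)]])
  have h_eq: "?h = x [^] p \<otimes> g [^] n \<otimes> inv x [^] p \<otimes> inv g [^] n \<otimes> (x [^] q \<otimes> g \<otimes> inv x [^] q)"
    using x g by (simp add: nat_pow_inv)
  have "?l ?h
      \<le> ?l (x [^] p) + ?l (g [^] n) + ?l (inv x [^] p) + ?l (inv g [^] n)
        + (?l (x [^] q) + ?l g + ?l (inv x [^] q))"
    unfolding h_eq using x g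
    by (intro order_trans[OF word_length_mult_le] add_mono order_refl) auto
  moreover have "?l g \<le> n * ?l g"
    using assms(3) by (cases n) auto
  ultimately have "?l ?h \<le> n * ?l x + n * ?l g + n * ?l (inv x) + n * ?l (inv g)
      + (n * ?l x + n * ?l g + n * ?l (inv x))"
    using pow[OF x, of p] pow[OF g, of n] pow[OF inv_closed[OF x], of p]
      pow[OF inv_closed[OF g], of n] pow[OF x, of q] pow[OF inv_closed[OF x], of q] assms(3,4)
    by linarith
  then show ?thesis
    by (simp add: algebra_simps)
qed

end

section \<open>The Heisenberg group\<close>

locale heisenberg = A: comm_group A for A :: "'a monoid" (structure) +
  fixes \<omega> :: "'a \<Rightarrow> 'a \<Rightarrow> int"
  assumes symplectic: "symplectic_form A \<omega>"
begin

abbreviation H where "H \<equiv> heisenberg_group A \<omega>"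

sublocale H: group H
  using group_heisenberg_group[OF A.comm_group_axioms symplectic] .

lemma form_add_left:
  "a \<in> carrier A \<Longrightarrow> b \<in> carrier A \<Longrightarrow> c \<in> carrier A \<Longrightarrow> \<omega> (a \<otimes> b) c = \<omega> a c + \<omega> b c"
  and form_add_right:
  "a \<in> carrier A \<Longrightarrow> b \<in> carrier A \<Longrightarrow> c \<in> carrier A \<Longrightarrow> \<omega> a (b \<otimes> c) = \<omega> a b + \<omega> a c"
  and form_alt: "a \<in> carrier A \<Longrightarrow> \<omega> a a = 0"
  using symplectic by (auto simp: symplectic_form_def)

lemma form_one_left: "a \<in> carrier A \<Longrightarrow> \<omega> \<one> a = 0"
  using form_add_left[of \<one> \<one> a] by simp

lemma form_one_right: "a \<in> carrier A \<Longrightarrow> \<omega> a \<one> = 0"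
  using form_add_right[of a \<one> \<one>] by simp

lemma form_skew:
  assumes "a \<in> carrier A" "b \<in> carrier A"
  shows "\<omega> b a = - \<omega> a b"
  using form_alt[of "a \<otimes> b"] form_alt[of a] form_alt[of b] assms
  by (simp add: form_add_left form_add_right)

lemma form_pow_left:
  "a \<in> carrier A \<Longrightarrow> b \<in> carrier A \<Longrightarrow> \<omega> (a [^] (n::nat)) b = int n * \<omega> a b"
  by (induction n) (auto simp: form_one_left form_add_left algebra_simps)

lemma form_pow_right:
  "a \<in> carrier A \<Longrightarrow> b \<in> carrier A \<Longrightarrow> \<omega> a (b [^] (n::nat)) = int n * \<omega> a b"
  by (induction n) (auto simp: form_one_right form_add_right algebra_simps)

lemma carrier_H: "carrier H = carrier A \<times> UNIV"
  by (simp add: heisenberg_group_def)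

lemma one_H: "\<one>\<^bsub>H\<^esub> = (\<one>, 0)"
  by (simp add: heisenberg_group_def)

lemma fst_closed: "x \<in> carrier H \<Longrightarrow> fst x \<in> carrier A"
  by (auto simp: carrier_H)

lemma mult_H: "x \<otimes>\<^bsub>H\<^esub> y = (fst x \<otimes> fst y, snd x + snd y + \<omega> (fst x) (fst y))"
  by (simp add: heisenberg_group_def split: prod.split)

lemma fst_pow_H: "x \<in> carrier H \<Longrightarrow> fst (x [^]\<^bsub>H\<^esub> (n::nat)) = fst x [^] n"
  by (induction n) (auto simp: one_H mult_H)

lemma vertical_mult:
  "y \<in> carrier H \<Longrightarrow> (\<one>, t) \<otimes>\<^bsub>H\<^esub> y = (fst y, t + snd y)"
  by (simp add: mult_H fst_closed form_one_left)

text \<open>Exchanging two factors replaces \<open>\<omega> (fst x) (fst y)\<close> by its negative in the vertical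
  coordinate, whence the factor \<open>2\<close>.\<close>

lemma conj_H:
  assumes "x \<in> carrier H" "y \<in> carrier H"
  shows "x \<otimes>\<^bsub>H\<^esub> y \<otimes>\<^bsub>H\<^esub> inv\<^bsub>H\<^esub> x = (fst y, snd y + 2 * \<omega> (fst x) (fst y))"
proof -
  have "x \<otimes>\<^bsub>H\<^esub> y = (fst y, snd y + 2 * \<omega> (fst x) (fst y)) \<otimes>\<^bsub>H\<^esub> x"
    using assms form_skew[of "fst x" "fst y"] by (simp add: mult_H fst_closed A.m_comm)
  then show ?thesis
    using assms(1) fst_closed[OF assms(2)]
    by (simp add: H.m_assoc[of "(fst y, _)"] carrier_H[THEN eqset_imp_iff, of "(fst y, _)"])
qed

lemma commutator_H:
  assumes "x \<in> carrier H" "y \<in> carrier H"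
  shows "x \<otimes>\<^bsub>H\<^esub> y \<otimes>\<^bsub>H\<^esub> inv\<^bsub>H\<^esub> x \<otimes>\<^bsub>H\<^esub> inv\<^bsub>H\<^esub> y = (\<one>, 2 * \<omega> (fst x) (fst y))"
proof -
  let ?c = "(\<one>, 2 * \<omega> (fst x) (fst y))"
  have "x \<otimes>\<^bsub>H\<^esub> y \<otimes>\<^bsub>H\<^esub> inv\<^bsub>H\<^esub> x = ?c \<otimes>\<^bsub>H\<^esub> y"
    using assms by (simp add: conj_H vertical_mult)
  moreover have "?c \<in> carrier H"
    by (simp add: carrier_H)
  ultimately show ?thesis
    using assms by (simp add: H.m_assoc)
qed

lemma fst_conjugacy_class:
  assumes "\<gamma> \<in> carrier H" "h \<in> conjugacy_class H \<gamma>"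
  shows "fst h = fst \<gamma>"
  using assms by (auto simp: conjugacy_class_def conj_H)

lemma noncentral_form_nonzero:
  assumes "\<gamma> \<in> carrier H" "\<gamma> \<notin> group_center H"
  obtains b where "b \<in> carrier A" "\<omega> b (fst \<gamma>) \<noteq> 0"
proof -
  obtain g where g: "g \<in> carrier H" "g \<otimes>\<^bsub>H\<^esub> \<gamma> \<noteq> \<gamma> \<otimes>\<^bsub>H\<^esub> g"
    using assms by (auto simp: group_center_def)
  then have "\<omega> (fst g) (fst \<gamma>) \<noteq> 0"
    using assms form_skew[of "fst g" "fst \<gamma>"] by (auto simp: mult_H fst_closed A.m_comm)
  with g that show thesis by (blast intro: fst_closed)
qed

end

section \<open>Quadratic distortion of the centre\<close>

locale finitely_generated_heisenberg = heisenberg A \<omega> for A :: "'a monoid" (structure) and \<omega> +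
  fixes S
  assumes fin_gen_H: "finite_generating_set (heisenberg_group A \<omega>) S"
begin

sublocale H: finitely_generated_group H S
  by unfold_locales (rule fin_gen_H)

lemma letter_bound:
  obtains M :: nat where
    "\<And>x. x \<in> S \<union> m_inv H ` S \<Longrightarrow> \<bar>snd x\<bar> \<le> int M"
    "\<And>x y. x \<in> S \<union> m_inv H ` S \<Longrightarrow> y \<in> S \<union> m_inv H ` S \<Longrightarrow> \<bar>\<omega> (fst x) (fst y)\<bar> \<le> int M"
proof -
  let ?T = "S \<union> m_inv H ` S"
  define B where "B = (\<lambda>x. nat \<bar>snd x\<bar>) ` ?T \<union> (\<lambda>(x, y). nat \<bar>\<omega> (fst x) (fst y)\<bar>) ` (?T \<times> ?T)"
  have "finite B"
    unfolding B_def
    by (intro finite_UnI[OF finite_imageI finite_imageI] finite_cartesian_product H.finite_letters)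
  then obtain M where M: "\<And>m. m \<in> B \<Longrightarrow> m \<le> M"
    by (meson finite_nat_set_iff_bounded_le)
  show thesis
  proof
    fix x assume x: "x \<in> ?T"
    then have "nat \<bar>snd x\<bar> \<in> B"
      unfolding B_def by blast
    then show "\<bar>snd x\<bar> \<le> int M"
      using M by fastforce
    fix y assume y: "y \<in> ?T"
    have "nat \<bar>\<omega> (fst x) (fst y)\<bar> \<in> B"
      unfolding B_def using x y by (intro UnI2 image_eqI[of _ _ "(x, y)"]) auto
    then show "\<bar>\<omega> (fst x) (fst y)\<bar> \<le> int M"
      using M by fastforce
  qed
qed

text \<open>Prefixing a letter to a word of length \<open>n\<close> changes the vertical coordinate by that of the
  letter and by a value of \<open>\<omega>\<close> that is at most \<open>M * n\<close>, by additivity in the second argument; the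
  sum of these linear increments is quadratic.\<close>

lemma vertical_coordinate_le:
  obtains M :: nat where
    "\<And>h. h \<in> carrier H \<Longrightarrow> \<bar>snd h\<bar> \<le> int (M * (word_length H S h)\<^sup>2)"
proof -
  let ?T = "S \<union> m_inv H ` S"
  let ?p = "\<lambda>w. foldr (\<otimes>\<^bsub>H\<^esub>) w \<one>\<^bsub>H\<^esub>"
  obtain M :: nat where
    M: "\<And>x. x \<in> ?T \<Longrightarrow> \<bar>snd x\<bar> \<le> int M"
       "\<And>x y. x \<in> ?T \<Longrightarrow> y \<in> ?T \<Longrightarrow> \<bar>\<omega> (fst x) (fst y)\<bar> \<le> int M"
    using letter_bound by blast
  have T: "fst x \<in> carrier A" if "x \<in> ?T" for x
    using that H.letters_carrier fst_closed by blast
  have form: "\<bar>\<omega> (fst x) (fst (?p w))\<bar> \<le> int M * int (length w)"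
    if "x \<in> ?T" "w \<in> group_words H S" for x w
    using that(2)
  proof (induction w)
    case Nil
    then show ?case using T[OF that(1)] by (simp add: one_H form_one_right)
  next
    case (Cons y w)
    then have y: "y \<in> ?T" and w: "w \<in> group_words H S"
      by (auto simp: group_words_def)
    have "\<omega> (fst x) (fst (?p (y # w))) = \<omega> (fst x) (fst y) + \<omega> (fst x) (fst (?p w))"
      using T[OF that(1)] T[OF y] fst_closed[OF H.word_prod_closed[OF w]]
      by (simp add: mult_H form_add_right)
    then show ?case
      using M(2)[OF that(1) y] Cons.IH[OF w] by (simp add: algebra_simps)
  qed
  have word_bound: "\<bar>snd (?p w)\<bar> \<le> int M * (int (length w))\<^sup>2" if "w \<in> group_words H S" for w
    using that
  proof (induction w)
    case Nil
    then show ?case by (simp add: one_H)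
  next
    case (Cons x w)
    then have x: "x \<in> ?T" and w: "w \<in> group_words H S"
      by (auto simp: group_words_def)
    have "snd (?p (x # w)) = snd x + snd (?p w) + \<omega> (fst x) (fst (?p w))"
      by (simp add: mult_H)
    then have "\<bar>snd (?p (x # w))\<bar>
        \<le> int M + int M * (int (length w))\<^sup>2 + int M * int (length w)"
      using M(1)[OF x] Cons.IH[OF w] form[OF x w] by linarith
    moreover have "int M + int M * (int (length w))\<^sup>2 + int M * int (length w)
        \<le> int M * (int (length (x # w)))\<^sup>2"
      by (simp add: algebra_simps power2_eq_square)
    ultimately show ?case
      by (rule order_trans)
  qed
  have "\<bar>snd h\<bar> \<le> int (M * (word_length H S h)\<^sup>2)" if h: "h \<in> carrier H" for h
  proof -
    obtain w where "w \<in> group_words H S" "length w = word_length H S h" "?p w = h"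
      using H.word_of_length[OF h] .
    then show ?thesis
      using word_bound[of w] by simp
  qed
  with that show thesis by blast
qed

text \<open>The conjugates by the powers of one element \<open>x\<close> are enough for a quadratic lower bound: the
  factor \<open>p * n\<close> of the exponent is produced by a commutator of length linear in \<open>n\<close>.\<close>

lemma word_length_conj_pow_le:
  assumes x: "x \<in> carrier H" and g: "\<gamma> \<in> carrier H" and "p < n" "q < n"
  defines "m \<equiv> p * n + q"
  shows "word_length H S (x [^]\<^bsub>H\<^esub> m \<otimes>\<^bsub>H\<^esub> \<gamma> \<otimes>\<^bsub>H\<^esub> inv\<^bsub>H\<^esub> (x [^]\<^bsub>H\<^esub> m))
      \<le> 2 * (word_length H S x + word_length H S (inv\<^bsub>H\<^esub> x)
            + word_length H S \<gamma> + word_length H S (inv\<^bsub>H\<^esub> \<gamma>)) * n"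
proof -
  let ?e = "\<omega> (fst x) (fst \<gamma>)"
  have conj: "x [^]\<^bsub>H\<^esub> i \<otimes>\<^bsub>H\<^esub> \<gamma> \<otimes>\<^bsub>H\<^esub> inv\<^bsub>H\<^esub> (x [^]\<^bsub>H\<^esub> i) = (fst \<gamma>, snd \<gamma> + 2 * int i * ?e)"
    for i :: nat
    using x g by (simp add: conj_H fst_pow_H form_pow_left fst_closed)
  have comm: "x [^]\<^bsub>H\<^esub> p \<otimes>\<^bsub>H\<^esub> \<gamma> [^]\<^bsub>H\<^esub> n \<otimes>\<^bsub>H\<^esub> inv\<^bsub>H\<^esub> (x [^]\<^bsub>H\<^esub> p) \<otimes>\<^bsub>H\<^esub> inv\<^bsub>H\<^esub> (\<gamma> [^]\<^bsub>H\<^esub> n)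
      = (\<one>, 2 * int (p * n) * ?e)"
    using x g by (simp add: commutator_H fst_pow_H form_pow_left form_pow_right fst_closed)
  have "x [^]\<^bsub>H\<^esub> m \<otimes>\<^bsub>H\<^esub> \<gamma> \<otimes>\<^bsub>H\<^esub> inv\<^bsub>H\<^esub> (x [^]\<^bsub>H\<^esub> m)
      = (x [^]\<^bsub>H\<^esub> p \<otimes>\<^bsub>H\<^esub> \<gamma> [^]\<^bsub>H\<^esub> n \<otimes>\<^bsub>H\<^esub> inv\<^bsub>H\<^esub> (x [^]\<^bsub>H\<^esub> p) \<otimes>\<^bsub>H\<^esub> inv\<^bsub>H\<^esub> (\<gamma> [^]\<^bsub>H\<^esub> n))
        \<otimes>\<^bsub>H\<^esub> (x [^]\<^bsub>H\<^esub> q \<otimes>\<^bsub>H\<^esub> \<gamma> \<otimes>\<^bsub>H\<^esub> inv\<^bsub>H\<^esub> (x [^]\<^bsub>H\<^esub> q))"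
    unfolding comm conj
    using g by (simp add: vertical_mult carrier_H fst_closed m_def algebra_simps)
  then show ?thesis
    using H.word_length_commutator_conj_le[OF x g assms(3,4)] by simp
qed

section \<open>Counting a conjugacy class in balls\<close>

lemma ball_count_conjugacy_class_le:
  assumes g: "\<gamma> \<in> carrier H"
  obtains M :: nat where "\<And>n. ball_count H S (conjugacy_class H \<gamma>) n \<le> 2 * M * n\<^sup>2 + 1"
proof -
  obtain M :: nat where M: "\<And>h. h \<in> carrier H \<Longrightarrow> \<bar>snd h\<bar> \<le> int (M * (word_length H S h)\<^sup>2)"
    using vertical_coordinate_le by blast
  have "ball_count H S (conjugacy_class H \<gamma>) n \<le> 2 * M * n\<^sup>2 + 1" for n
  proof -
    let ?I = "{- int (M * n\<^sup>2)..int (M * n\<^sup>2)}"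
    have "conjugacy_class H \<gamma> \<inter> word_ball H S \<one>\<^bsub>H\<^esub> n \<subseteq> {fst \<gamma>} \<times> ?I"
    proof
      fix h assume h: "h \<in> conjugacy_class H \<gamma> \<inter> word_ball H S \<one>\<^bsub>H\<^esub> n"
      then have hH: "h \<in> carrier H" and "word_length H S h \<le> n"
        by (auto simp: H.mem_word_ball_one_iff)
      then have "M * (word_length H S h)\<^sup>2 \<le> M * n\<^sup>2"
        by (intro mult_left_mono power_mono) auto
      with M[OF hH] have "\<bar>snd h\<bar> \<le> int (M * n\<^sup>2)"
        by linarith
      moreover have "fst h = fst \<gamma>"
        using fst_conjugacy_class[OF g] h by blast
      ultimately show "h \<in> {fst \<gamma>} \<times> ?I"
        by (cases h) auto
    qed
    then have "ball_count H S (conjugacy_class H \<gamma>) n \<le> card ({fst \<gamma>} \<times> ?I)"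
      unfolding ball_count_def by (intro card_mono) auto
    also have "\<dots> = 2 * M * n\<^sup>2 + 1"
    proof -
      have "card ?I = nat (int (2 * M * n\<^sup>2 + 1))"
        unfolding card_atLeastAtMost_int by (rule arg_cong[of _ _ nat]) simp
      then show ?thesis
        by (simp only: card_cartesian_product nat_int) simp
    qed
    finally show ?thesis .
  qed
  with that show thesis by blast
qed

lemma ball_count_conjugacy_class_ge:
  assumes g: "\<gamma> \<in> carrier H" and nc: "\<gamma> \<notin> group_center H"
  obtains L :: nat where "\<And>c n. L \<le> c \<Longrightarrow> n\<^sup>2 \<le> ball_count H S (conjugacy_class H \<gamma>) (c * n)"
proof -
  obtain b where b: "b \<in> carrier A" "\<omega> b (fst \<gamma>) \<noteq> 0"
    using noncentral_form_nonzero[OF g nc] by blast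
  define x where "x = (b, 0::int)"
  have x: "x \<in> carrier H"
    using b by (simp add: x_def carrier_H)
  define conj where "conj m = x [^]\<^bsub>H\<^esub> m \<otimes>\<^bsub>H\<^esub> \<gamma> \<otimes>\<^bsub>H\<^esub> inv\<^bsub>H\<^esub> (x [^]\<^bsub>H\<^esub> m)" for m :: nat
  define L where "L = 2 * (word_length H S x + word_length H S (inv\<^bsub>H\<^esub> x)
            + word_length H S \<gamma> + word_length H S (inv\<^bsub>H\<^esub> \<gamma>))"
  have "conj m = (fst \<gamma>, snd \<gamma> + 2 * int m * \<omega> b (fst \<gamma>))" for m
    using x g b by (simp add: conj_def conj_H fst_pow_H form_pow_left fst_closed x_def)
  then have inj: "inj conj"
    using b(2) by (auto simp: inj_def)
  have "n\<^sup>2 \<le> ball_count H S (conjugacy_class H \<gamma>) (c * n)" if "L \<le> c" for c n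
  proof -
    have "conj ` {..<n\<^sup>2} \<subseteq> conjugacy_class H \<gamma> \<inter> word_ball H S \<one>\<^bsub>H\<^esub> (c * n)"
    proof
      fix h assume "h \<in> conj ` {..<n\<^sup>2}"
      then obtain m where m: "m < n\<^sup>2" and h: "h = conj m"
        by auto
      \<comment> \<open>The two digits of \<open>m\<close> in base \<open>n\<close>.\<close>
      have "m div n < n" "m mod n < n"
        using m by (cases "n = 0"; simp add: power2_eq_square less_mult_imp_div_less)+
      then have "word_length H S h \<le> L * n"
        using word_length_conj_pow_le[OF x g, of "m div n" n "m mod n"]
        by (simp add: h conj_def L_def)
      also have "\<dots> \<le> c * n"
        using that by simp
      finally have "word_length H S h \<le> c * n" .
      moreover have "h \<in> conjugacy_class H \<gamma>" "h \<in> carrier H"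
        using x g unfolding h conj_def conjugacy_class_def
        by (auto intro!: exI[of _ "x [^]\<^bsub>H\<^esub> m"] simp del: split_paired_Ex)
      ultimately show "h \<in> conjugacy_class H \<gamma> \<inter> word_ball H S \<one>\<^bsub>H\<^esub> (c * n)"
        by (simp add: H.mem_word_ball_one_iff)
    qed
    then have "card (conj ` {..<n\<^sup>2}) \<le> ball_count H S (conjugacy_class H \<gamma>) (c * n)"
      unfolding ball_count_def
      using finite_word_ball[OF H.is_group fin_gen_H] by (intro card_mono) auto
    then show ?thesis
      using inj by (simp add: card_image inj_on_subset)
  qed
  with that show thesis by blast
qed

lemma ball_count_noncentral_zero:
  assumes g: "\<gamma> \<in> carrier H" and nc: "\<gamma> \<notin> group_center H"
  shows "ball_count H S (conjugacy_class H \<gamma>) 0 = 0"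
proof -
  have "fst \<gamma> \<noteq> \<one>"
    using noncentral_form_nonzero[OF g nc] form_one_right by metis
  then have "\<one>\<^bsub>H\<^esub> \<notin> conjugacy_class H \<gamma>"
    using fst_conjugacy_class[OF g] by (force simp: one_H)
  then show ?thesis
    by (simp add: ball_count_def H.word_ball_zero)
qed

end

theorem proposition6:
  fixes A :: "'a monoid" and \<omega> :: "'a \<Rightarrow> 'a \<Rightarrow> int" and k :: nat
    and \<Gamma> :: "('a \<times> int) monoid" and S K :: "('a \<times> int) set" and \<gamma> :: "'a \<times> int"
  assumes "k \<ge> 1"
    and "free_abelian_of_rank A (2 * k)"
    and "symplectic_form A \<omega>"
    and "\<Gamma> = heisenberg_group A \<omega>"
    and "finite_generating_set \<Gamma> S"
    and "\<gamma> \<in> carrier \<Gamma>"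
    and "\<gamma> \<notin> group_center \<Gamma>"
    and "K = conjugacy_class \<Gamma> \<gamma>"
  shows "(\<lambda>n. real (ball_count \<Gamma> S K n)) \<asymp> (\<lambda>n. real n ^ 2)"
proof -
  interpret comm_group A
    using assms(2) by (simp add: free_abelian_of_rank_def)
  interpret finitely_generated_heisenberg A \<omega> S
    using assms(3-5) by unfold_locales auto
  note g = assms(6,7)[unfolded assms(4)]
  obtain M where M: "\<And>n. ball_count \<Gamma> S K n \<le> 2 * M * n\<^sup>2 + 1"
    using ball_count_conjugacy_class_le[OF g(1)] unfolding assms(4,8) by blast
  obtain L where L: "\<And>c n. L \<le> c \<Longrightarrow> n\<^sup>2 \<le> ball_count \<Gamma> S K (c * n)"
    using ball_count_conjugacy_class_ge[OF g] unfolding assms(4,8) by blast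
  define c where "c = 2 * M + L + 1"
  \<comment> \<open>The summand \<open>1\<close> in the bound from \<open>M\<close> is absorbed by \<open>n^2\<close> only if \<open>n > 0\<close>; at \<open>n = 0\<close> the
    count vanishes because the class does not contain the identity.\<close>
  have upper: "ball_count \<Gamma> S K n \<le> (c * n)\<^sup>2" for n
  proof (cases "n = 0")
    case True
    then show ?thesis
      using ball_count_noncentral_zero[OF g] by (simp add: assms(4,8))
  next
    case False
    then have "2 * M * n\<^sup>2 + 1 \<le> (2 * M + 1) * n\<^sup>2"
      by simp
    also have "\<dots> \<le> c\<^sup>2 * n\<^sup>2"
      by (intro mult_right_mono) (auto simp: c_def power2_eq_square)
    finally show ?thesis
      using M[of n] by (simp add: power_mult_distrib)
  qed
  have "real n ^ 2 \<le> real (ball_count \<Gamma> S K (c * n))"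
    and "real (ball_count \<Gamma> S K n) \<le> real (c * n) ^ 2" for n
    using L[of c n] upper[of n] unfolding of_nat_power[symmetric] of_nat_le_iff
    by (simp_all add: c_def)
  then show ?thesis
    unfolding growth_equiv_def by (intro exI[of _ c]) (auto simp: c_def)
qed

end
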